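(* Let $G$ be a connected graph and let $x$ be a vertex of $G$ that is not a cut vertex and that belongs to some outer general position set of $G$ of cardinality $\mathrm{gp}_{\rm o}(G)$. Then $\mathrm{gp}_{\rm o}(G)-1\le \mathrm{gp}_{\rm o}(G-x)$. Moreover, this bound is sharp, i.e., equality holds for some such $G$ and $x$.
   Context: All graphs are finite, simple and connected. For a graph $G$ and $Z\subseteq V(G)$, two vertices $p,q\in V(G)$ are $Z$-positionable if no shortest $p,q$-path in $G$ has an internal vertex in $Z$. $Z$ is an outer general position set if every two vertices of $Z$ are $Z$-positionable and every $p\in Z$, $q\in V(G)\setminus Z$ are $Z$-positionable. $\mathrm{gp}_{\rm o}(G)$ is the maximum cardinality of an outer general position set of $G$. $G-x$ is the graph obtained by deleting $x$ and its incident edges. *)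

theory Defs
  imports "Graph_Theory.Graph_Theory"
begin

text \<open>
  Finite simple graphs are the locale \<^locale>\<open>graph\<close>: finite symmetric digraphs without loops
  and parallel arcs. An undirected edge is a pair of opposite arcs, and for a fixed start vertex
  the paths of such a digraph, given as arc lists, are the paths of the undirected graph.
\<close>

definition shortest_path :: "('a, 'b) pre_digraph \<Rightarrow> 'a \<Rightarrow> 'b list \<Rightarrow> 'a \<Rightarrow> bool" where
  "shortest_path G p P q \<longleftrightarrow>
     pre_digraph.apath G p P q \<and> (\<forall>Q. pre_digraph.apath G p Q q \<longrightarrow> length P \<le> length Q)"

definition positionable :: "('a, 'b) pre_digraph \<Rightarrow> 'a set \<Rightarrow> 'a \<Rightarrow> 'a \<Rightarrow> bool" where
  "positionable G Z p q \<longleftrightarrow>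
     \<not> (\<exists>P. shortest_path G p P q \<and> set (pre_digraph.inner_verts G P) \<inter> Z \<noteq> {})"

definition outer_general_position_set :: "('a, 'b) pre_digraph \<Rightarrow> 'a set \<Rightarrow> bool" where
  "outer_general_position_set G Z \<longleftrightarrow>
     Z \<subseteq> verts G \<and>
     (\<forall>p\<in>Z. \<forall>q\<in>Z. p \<noteq> q \<longrightarrow> positionable G Z p q) \<and>
     (\<forall>p\<in>Z. \<forall>q\<in>verts G - Z. positionable G Z p q)"

definition gp_o :: "('a, 'b) pre_digraph \<Rightarrow> nat" where
  "gp_o G = Max {card Z | Z. outer_general_position_set G Z}"

text \<open>
  In a symmetric digraph the strongly connected components are the connected components of the
  undirected graph. Under this definition the only vertex of a one-vertex graph is not a cut vertex.
\<close>

definition cut_vertex :: "('a, 'b) pre_digraph \<Rightarrow> 'a \<Rightarrow> bool" where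
  "cut_vertex G x \<longleftrightarrow> x \<in> verts G \<and>
     card (pre_digraph.sccs_verts (pre_digraph.del_vert G x)) > card (pre_digraph.sccs_verts G)"

end

theory Submission
  imports Defs
begin

text \<open>
  Let \<open>Z\<close> be an outer general position set containing \<open>x\<close>. A shortest path starting in
  \<open>Z - {x}\<close> and ending at a vertex other than \<open>x\<close> has no inner vertex in \<open>Z\<close>, so it avoids \<open>x\<close>.
  Hence deleting \<open>x\<close> changes neither the distances from \<open>Z - {x}\<close> nor the shortest paths starting
  there, and \<open>Z - {x}\<close> is an outer general position set of \<open>G - x\<close>.
  Equality holds for the complete graph on two vertices.
\<close>

context wf_digraph
begin

text \<open>Deletion keeps \<open>tail\<close> and \<open>head\<close>, the only data of the graph
  that this list uses.\<close>

lemma awalk_verts_del_vert: "pre_digraph.awalk_verts (del_vert x) u P = awalk_verts u P"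
  by (simp add: pre_digraph.awalk_verts_conv del_vert_simps)

lemma inner_verts_del_vert: "pre_digraph.inner_verts (del_vert x) P = inner_verts P"
  by (simp add: pre_digraph.inner_verts_def del_vert_simps)

lemma apath_del_vert_iff:
  "pre_digraph.apath (del_vert x) u P v \<longleftrightarrow> apath u P v \<and> x \<notin> set (awalk_verts u P)"
proof -
  have "pre_digraph.awalk (del_vert x) u P v \<longleftrightarrow> awalk u P v \<and> x \<notin> set (awalk_verts u P)"
  proof (induct P arbitrary: u)
    case Nil
    show ?case
      by (auto simp: pre_digraph.awalk_def pre_digraph.cas.simps del_vert_simps)
  next
    case (Cons e P)
    interpret D: wf_digraph "del_vert x" by (rule wf_digraph_del_vert)
    show ?case
      unfolding D.awalk_Cons_iff awalk_Cons_iff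
      \<comment> \<open>The arc \<open>e\<close> survives iff neither end is \<open>x\<close>. Its
        head begins the remaining walk, so avoidance there already covers it.\<close>
      using Cons[of "head G e"] hd_in_awalk_verts(1)[of "head G e" P v]
      by (auto simp: del_vert_simps)
  qed
  then show ?thesis
    by (auto simp: pre_digraph.apath_def awalk_verts_del_vert)
qed

lemma shortest_path_exists:
  assumes "apath u Q v"
  obtains P where "shortest_path G u P v"
  using ex_has_least_nat[of "\<lambda>P. apath u P v" Q length] assms
  unfolding shortest_path_def by blast

text \<open>The two positionability clauses together cover every end \<open>q\<close>, inside or
  outside \<open>Z\<close>; on a path the inner vertices are all vertices but the two ends.\<close>

lemma outer_general_position_setD:
  assumes "outer_general_position_set G Z" "p \<in> Z" "q \<in> verts G" "p \<noteq> q"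
    and "shortest_path G p P q"
  shows "set (awalk_verts p P) \<inter> Z \<subseteq> {p, q}"
proof -
  have "set (inner_verts P) \<inter> Z = {}"
    using assms unfolding outer_general_position_set_def positionable_def by blast
  moreover have "set (inner_verts P) = set (awalk_verts p P) - {p, q}"
    using assms by (simp add: shortest_path_def set_inner_verts)
  ultimately show ?thesis by blast
qed

lemma outer_general_position_set_del_vert:
  assumes Z: "outer_general_position_set G Z" and x: "x \<in> Z"
  shows "outer_general_position_set (del_vert x) (Z - {x})"
proof -
  have *: "positionable (del_vert x) (Z - {x}) p q"
    if pq: "p \<in> Z" "p \<noteq> x" "q \<in> verts G" "q \<noteq> x" "p \<noteq> q" for p q
    unfolding positionable_def
  proof (intro notI, elim exE conjE)
    fix P
    assume P: "shortest_path (del_vert x) p P q"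
      and ne: "set (pre_digraph.inner_verts (del_vert x) P) \<inter> (Z - {x}) \<noteq> {}"
    have aP: "apath p P q" using P by (simp add: shortest_path_def apath_del_vert_iff)
    then obtain Q where Q: "shortest_path G p Q q" by (rule shortest_path_exists)
    \<comment> \<open>As \<open>x\<close> lies in \<open>Z\<close> and is neither end of
      \<open>Q\<close>, the path \<open>Q\<close> survives the deletion and competes with
      \<open>P\<close> there.\<close>
    have "x \<notin> set (awalk_verts p Q)"
      using outer_general_position_setD[OF Z _ _ _ Q] pq x by blast
    then have "length P \<le> length Q"
      using P Q by (simp add: shortest_path_def apath_del_vert_iff)
    \<comment> \<open>\<open>P\<close> is a path of \<open>G\<close> no longer than the shortest
      path \<open>Q\<close>, so the hypothesis on \<open>Z\<close> applies to \<open>P\<close>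
      itself.\<close>
    then have "shortest_path G p P q"
      using Q aP order_trans unfolding shortest_path_def by blast
    then have "set (inner_verts P) \<inter> Z = {}"
      using outer_general_position_setD[OF Z _ _ _, of p q P] pq set_inner_verts[OF aP] by blast
    with ne show False by (auto simp: inner_verts_del_vert)
  qed
  show ?thesis
    using Z * unfolding outer_general_position_set_def by (auto simp: del_vert_simps)
qed

end

context fin_digraph
begin

text \<open>Ensures that the \<open>Max\<close> in \<open>gp_o\<close> is a genuine maximum.\<close>

lemma finite_card_outer_general_position_sets:
  "finite {card Z | Z. outer_general_position_set G Z}"
proof -
  have "{card Z | Z. outer_general_position_set G Z} \<subseteq> card ` Pow (verts G)"
    by (auto simp: outer_general_position_set_def)
  then show ?thesis by (rule finite_subset) simp
qed

lemma card_le_gp_o: "outer_general_position_set G Z \<Longrightarrow> card Z \<le> gp_o G"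
  unfolding gp_o_def by (rule Max_ge[OF finite_card_outer_general_position_sets]) blast

lemma gp_o_le_card_verts: "gp_o G \<le> card (verts G)"
proof -
  \<comment> \<open>\<open>Max_le_iff\<close> requires a nonempty set of cardinalities.\<close>
  have "outer_general_position_set G {}" by (simp add: outer_general_position_set_def)
  then show ?thesis
    unfolding gp_o_def
    by (subst Max_le_iff[OF finite_card_outer_general_position_sets])
      (auto simp: outer_general_position_set_def intro: card_mono)
qed

text \<open>Two distinct ends exhaust the vertices, so no path between them has an inner
  vertex.\<close>

lemma outer_general_position_set_verts:
  assumes "card (verts G) \<le> 2"
  shows "outer_general_position_set G (verts G)"
proof -
  have "positionable G (verts G) p q" if "p \<in> verts G" "q \<in> verts G" "p \<noteq> q" for p q
  proof -
    have "verts G = {p, q}"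
      using that assms by (intro card_seteq[symmetric]) auto
    then show ?thesis
      using set_inner_verts unfolding positionable_def shortest_path_def by blast
  qed
  then show ?thesis
    by (simp add: outer_general_position_set_def)
qed

lemma gp_o_eq_card_verts: "card (verts G) \<le> 2 \<Longrightarrow> gp_o G = card (verts G)"
  by (intro le_antisym gp_o_le_card_verts card_le_gp_o outer_general_position_set_verts)

end

lemma gp_o_del_vert_ge:
  assumes "fin_digraph G" "outer_general_position_set G Z" "card Z = gp_o G" "x \<in> Z"
  shows "gp_o G - 1 \<le> gp_o (pre_digraph.del_vert G x)"
proof -
  interpret fin_digraph G by fact
  interpret D: fin_digraph "del_vert x" by (rule fin_digraph_del_vert)
  show ?thesis
    using D.card_le_gp_o[OF outer_general_position_set_del_vert[OF assms(2,4)]] assms(3,4)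
    by simp
qed

definition K2 :: "(nat, nat \<times> nat) pre_digraph" where
  "K2 = \<lparr>verts = {0, 1}, arcs = {(0, 1), (1, 0)}, tail = fst, head = snd\<rparr>"

lemma graph_K2: "graph K2"
  by unfold_locales (auto simp: K2_def arc_to_ends_def symmetric_conv)

interpretation K2: graph K2
  by (rule graph_K2)

interpretation K2_minus: fin_digraph "pre_digraph.del_vert K2 0"
  by (rule K2.fin_digraph_del_vert)

lemma verts_K2: "verts K2 = {0, 1}" "verts (pre_digraph.del_vert K2 0) = {1}"
  by (auto simp: K2_def pre_digraph.verts_del_vert)

lemma connected_K2: "Digraph_Component.connected K2"
proof -
  \<comment> \<open>\<open>connected\<close> refers to the symmetric closure, whose reachability
    agrees with that of the symmetric digraph \<open>K2\<close>.\<close>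
  have "0 \<rightarrow>\<^bsub>K2\<^esub> 1" "1 \<rightarrow>\<^bsub>K2\<^esub> 0"
    by (auto simp: K2_def arcs_ends_conv)
  then have "u \<rightarrow>\<^sup>*\<^bsub>mk_symmetric K2\<^esub> v" if "u \<in> verts K2" "v \<in> verts K2" for u v
    using that by (subst K2.reachable_mk_symmetric_eq[OF K2.sym_arcs]) (auto simp: verts_K2)
  then show ?thesis
    by (auto simp: connected_def strongly_connected_def verts_K2)
qed

lemma not_cut_vertex_K2: "\<not> cut_vertex K2 0"
proof -
  \<comment> \<open>Each component is the component of some vertex, and only the vertex
    \<open>1\<close> is left.\<close>
  have "card (K2_minus.sccs_verts) \<le> 1"
    by (simp add: K2_minus.sccs_verts_conv_scc_of verts_K2)
  moreover have "card (K2.sccs_verts) \<ge> 1"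
    using K2.finite_sccs_verts
    by (simp add: K2.sccs_verts_conv_scc_of verts_K2 Suc_le_eq card_gt_0_iff)
  ultimately show ?thesis by (simp add: cut_vertex_def)
qed

lemma gp_o_K2: "gp_o K2 = 2" "gp_o (pre_digraph.del_vert K2 0) = 1"
  by (simp_all add: K2.gp_o_eq_card_verts K2_minus.gp_o_eq_card_verts verts_K2)

theorem theorem3p3:
  shows
    "(\<forall>(G :: ('a, 'b) pre_digraph) x.
        graph G \<and> Digraph_Component.connected G \<and> x \<in> verts G \<and> \<not> cut_vertex G x \<and>
        (\<exists>Z. outer_general_position_set G Z \<and> card Z = gp_o G \<and> x \<in> Z) \<longrightarrow>
        int (gp_o G) - 1 \<le> int (gp_o (pre_digraph.del_vert G x))) \<and>
     (\<exists>(G :: (nat, nat \<times> nat) pre_digraph) x.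
        graph G \<and> Digraph_Component.connected G \<and> x \<in> verts G \<and> \<not> cut_vertex G x \<and>
        (\<exists>Z. outer_general_position_set G Z \<and> card Z = gp_o G \<and> x \<in> Z) \<and>
        verts (pre_digraph.del_vert G x) \<noteq> {} \<and>
        int (gp_o G) - 1 = int (gp_o (pre_digraph.del_vert G x)))"
proof (intro conjI allI impI, elim conjE exE)
  fix G :: "('a, 'b) pre_digraph" and x Z
  assume "graph G" and Z: "outer_general_position_set G Z" "card Z = gp_o G" "x \<in> Z"
  then interpret graph G by simp
  show "int (gp_o G) - 1 \<le> int (gp_o (pre_digraph.del_vert G x))"
    \<comment> \<open>Truncated subtraction on \<open>nat\<close> is at least the integer
      difference, so the bound carries over.\<close>
    using gp_o_del_vert_ge[OF fin_digraph Z] by linarith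
next
  have "outer_general_position_set K2 (verts K2) \<and> card (verts K2) = gp_o K2 \<and> 0 \<in> verts K2"
    using K2.outer_general_position_set_verts by (simp add: verts_K2 gp_o_K2)
  then show "\<exists>(G :: (nat, nat \<times> nat) pre_digraph) x.
        graph G \<and> Digraph_Component.connected G \<and> x \<in> verts G \<and> \<not> cut_vertex G x \<and>
        (\<exists>Z. outer_general_position_set G Z \<and> card Z = gp_o G \<and> x \<in> Z) \<and>
        verts (pre_digraph.del_vert G x) \<noteq> {} \<and>
        int (gp_o G) - 1 = int (gp_o (pre_digraph.del_vert G x))"
    using graph_K2 connected_K2 not_cut_vertex_K2
    by (intro exI[of _ K2] exI[of _ 0]) (auto simp: gp_o_K2 verts_K2)
qed

end
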